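(* Let $\nu,d\in\mathbb{C}$ with $|\nu|\le 1$, let $\Phi(z)=\nu z-d$, and let $\Upsilon$ be an entire function on $\mathbb{C}$ such that the weighted composition operator $C_{\Upsilon,\Phi}$ is bounded on $H_E(\zeta)$. If $C_{\Upsilon,\Phi}$ is a co-isometry, then $$\Upsilon(z)=\alpha\,\frac{K_{\overline{\nu}d}(z)}{\|K_{\overline{\nu}d}\|}\quad\text{for all } z\in\mathbb{C},$$ where $\alpha=\dfrac{1}{\overline{\Upsilon(0)}\,\|K_{\overline{\nu}d}\|}$, $|\alpha|=\zeta_0$ and $|\nu|=1$.
   Context: Let $\mathbb{N}_0=\mathbb{N}\cup\{0\}$ and let $\zeta=(\zeta_n)_{n\in\mathbb{N}_0}$ be a sequence of positive real numbers with $\lim_{n\to\infty}\zeta_n^{1/n}=\infty$. The weighted Hardy space of entire functions induced by $\zeta$ is the Hilbert space $H_E(\zeta)=\{g(z)=\sum_{n=0}^\infty b_nz^n : \|g\|^2=\sum_{n=0}^\infty |b_n|^2\zeta_n^2<\infty\}$ of entire functions on $\mathbb{C}$, with inner product $\langle g,h\rangle=\sum_{n=0}^\infty b_n\overline{c_n}\zeta_n^2$ for $g(z)=\sum b_nz^n$ and $h(z)=\sum c_nz^n$ in $H_E(\zeta)$. For $p\in\mathbb{C}$, the reproducing kernel is $K_p(w)=\sum_{n=0}^\infty \frac{1}{\zeta_n^2}\overline{p}^{\,n}w^n$ for $w\in\mathbb{C}$, which satisfies $f(p)=\langle f,K_p\rangle$ for all $f\in H_E(\zeta)$. For entire functions $\Upsilon,\Phi:\mathbb{C}\to\mathbb{C}$,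 the weighted composition operator is $C_{\Upsilon,\Phi}f=\Upsilon\cdot(f\circ\Phi)$; it is bounded on $H_E(\zeta)$ if it maps $H_E(\zeta)$ into itself as a bounded linear operator. A bounded linear operator $S$ on a Hilbert space $H$ is a co-isometry if $S^*$ is an isometry, equivalently $SS^*=I_H$. *)

theory Defs
  imports "HOL-Complex_Analysis.Complex_Analysis"
begin

text \<open>
  The weight \<open>\<zeta>\<close> is a parameter, so the spaces \<open>H\<^sub>E(\<zeta>)\<close> are carrier sets of functions
  \<open>\<complex> \<Rightarrow> \<complex>\<close> rather than types.
\<close>

definition tcoeff :: "(complex \<Rightarrow> complex) \<Rightarrow> nat \<Rightarrow> complex" where
  "tcoeff g n = fps_nth (fps_expansion g 0) n"

definition HE :: "(nat \<Rightarrow> real) \<Rightarrow> (complex \<Rightarrow> complex) set" where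
  "HE \<zeta> = {g. g holomorphic_on UNIV \<and> summable (\<lambda>n. (cmod (tcoeff g n))\<^sup>2 * (\<zeta> n)\<^sup>2)}"

definition HE_inner ::
    "(nat \<Rightarrow> real) \<Rightarrow> (complex \<Rightarrow> complex) \<Rightarrow> (complex \<Rightarrow> complex) \<Rightarrow> complex" where
  "HE_inner \<zeta> g h = (\<Sum>n. tcoeff g n * cnj (tcoeff h n) * of_real ((\<zeta> n)\<^sup>2))"

definition HE_norm :: "(nat \<Rightarrow> real) \<Rightarrow> (complex \<Rightarrow> complex) \<Rightarrow> real" where
  "HE_norm \<zeta> g = sqrt (\<Sum>n. (cmod (tcoeff g n))\<^sup>2 * (\<zeta> n)\<^sup>2)"

definition HE_kernel :: "(nat \<Rightarrow> real) \<Rightarrow> complex \<Rightarrow> complex \<Rightarrow> complex" where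
  "HE_kernel \<zeta> p w = (\<Sum>n. of_real (1 / (\<zeta> n)\<^sup>2) * cnj p ^ n * w ^ n)"

definition wcomp ::
    "(complex \<Rightarrow> complex) \<Rightarrow> (complex \<Rightarrow> complex) \<Rightarrow> (complex \<Rightarrow> complex) \<Rightarrow> complex \<Rightarrow> complex"
  where "wcomp \<Upsilon> \<Phi> f = (\<lambda>z. \<Upsilon> z * f (\<Phi> z))"

definition HE_bounded_op ::
    "(nat \<Rightarrow> real) \<Rightarrow> ((complex \<Rightarrow> complex) \<Rightarrow> complex \<Rightarrow> complex) \<Rightarrow> bool" where
  "HE_bounded_op \<zeta> S \<longleftrightarrow>
     (\<forall>f\<in>HE \<zeta>. S f \<in> HE \<zeta>) \<and>
     (\<forall>f\<in>HE \<zeta>. \<forall>g\<in>HE \<zeta>. S (\<lambda>z. f z + g z) = (\<lambda>z. S f z + S g z)) \<and>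
     (\<forall>c. \<forall>f\<in>HE \<zeta>. S (\<lambda>z. c * f z) = (\<lambda>z. c * S f z)) \<and>
     (\<exists>B. \<forall>f\<in>HE \<zeta>. HE_norm \<zeta> (S f) \<le> B * HE_norm \<zeta> f)"

text \<open>
  The Hilbert space adjoint. For a bounded \<open>S\<close> and \<open>g\<close> in the space, the \<open>h\<close> below exists and is
  unique by the Riesz representation theorem; otherwise the value is unspecified.
\<close>

definition HE_adjoint ::
    "(nat \<Rightarrow> real) \<Rightarrow> ((complex \<Rightarrow> complex) \<Rightarrow> complex \<Rightarrow> complex) \<Rightarrow>
     (complex \<Rightarrow> complex) \<Rightarrow> complex \<Rightarrow> complex" where
  "HE_adjoint \<zeta> S g =
     (THE h. h \<in> HE \<zeta> \<and> (\<forall>f\<in>HE \<zeta>. HE_inner \<zeta> (S f) g = HE_inner \<zeta> f h))"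

definition HE_isometry ::
    "(nat \<Rightarrow> real) \<Rightarrow> ((complex \<Rightarrow> complex) \<Rightarrow> complex \<Rightarrow> complex) \<Rightarrow> bool" where
  "HE_isometry \<zeta> T \<longleftrightarrow> HE_bounded_op \<zeta> T \<and> (\<forall>g\<in>HE \<zeta>. HE_norm \<zeta> (T g) = HE_norm \<zeta> g)"

definition HE_coisometry ::
    "(nat \<Rightarrow> real) \<Rightarrow> ((complex \<Rightarrow> complex) \<Rightarrow> complex \<Rightarrow> complex) \<Rightarrow> bool" where
  "HE_coisometry \<zeta> S \<longleftrightarrow> HE_bounded_op \<zeta> S \<and> HE_isometry \<zeta> (HE_adjoint \<zeta> S)"

end

theory Submission
  imports Defs
begin

text \<open>
  With $\kappa(t) = \sum_n t^n / \zeta_n^2$ we have $\langle K_p, K_q\rangle = \kappa(\overline p q)$,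
  and the adjoint sends $K_p$ to $\overline{\Upsilon(p)} K_{\Phi(p)}$. By polarization the
  co-isometry hypothesis thus becomes the functional equation
  $\kappa(\overline p q) = \overline{\Upsilon(p)} \Upsilon(q) \kappa(\overline{\Phi(p)} \Phi(q))$.
  It makes the normalized quantity
  $|\kappa(\overline p q)|^2 / (\kappa(|p|^2) \kappa(|q|^2))$ invariant under $\Phi$. If
  $|\nu| < 1$, iterating $\Phi$ from $p = 0$ and $q = 1$ drives both points to the fixed point of
  $\Phi$, where the quantity is $1$, whereas its initial value is $\kappa(0)/\kappa(1) < 1$. Hence
  $|\nu| = 1$, so $\Phi(\overline\nu d) = 0$, and the functional equation at $p = \overline\nu d$
  yields $\Upsilon$.
\<close>

section \<open>Taylor expansions of entire functions\<close>

lemma sums_tcoeff: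
  assumes "f holomorphic_on UNIV"
  shows "(\<lambda>n. tcoeff f n * z ^ n) sums f z"
proof -
  have "(\<lambda>n. (deriv ^^ n) f 0 / fact n * (z - 0) ^ n) sums f z"
    by (rule holomorphic_power_series[where r = "norm z + 1"])
      (use assms in \<open>auto intro: holomorphic_on_subset\<close>)
  then show ?thesis by (simp add: tcoeff_def fps_expansion_def)
qed

text \<open>Convergence at every point forces an infinite radius of convergence, so \<open>f\<close>
  is \<open>eval_fps\<close> of a formal series, and uniqueness of the expansion at 0 identifies its
  coefficients.\<close>

lemma
  fixes a :: "nat \<Rightarrow> complex"
  assumes "\<And>z. (\<lambda>n. a n * z ^ n) sums f z"
  shows holomorphic_power_series_UNIV: "f holomorphic_on UNIV"
    and tcoeff_power_series: "tcoeff f n = a n"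
proof -
  define F where "F = Abs_fps a"
  have f: "f = eval_fps F"
    using assms by (auto simp: F_def eval_fps_def sums_iff fun_eq_iff)
  have R: "fps_conv_radius F = \<infinity>"
    unfolding fps_conv_radius_def F_def
    by (rule conv_radius_inftyI'') (use assms in \<open>auto simp: sums_iff\<close>)
  show "f holomorphic_on UNIV"
    unfolding f by (rule holomorphic_on_eval_fps) (simp add: R)
  have "f has_fps_expansion F"
    unfolding f by (rule eval_fps_has_fps_expansion) (simp add: R)
  from fps_nth_fps_expansion[OF this, of n] show "tcoeff f n = a n"
    by (simp add: tcoeff_def fps_expansion_def F_def)
qed

section \<open>The weight and its generating function\<close>

locale entire_weight =
  fixes \<zeta> :: "nat \<Rightarrow> real"
  assumes pos: "\<And>n. \<zeta> n > 0"
    and lim: "filterlim (\<lambda>n. root n (\<zeta> n)) at_top sequentially"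
begin

text \<open>All kernels come from this one function of one variable, so its continuity gives joint
  continuity of the kernel in both of its points.\<close>

definition \<kappa> :: "complex \<Rightarrow> complex" where
  "\<kappa> = eval_fps (Abs_fps (\<lambda>n. of_real (1 / (\<zeta> n)\<^sup>2)))"

lemma weight_neq_0 [simp]: "\<zeta> n \<noteq> 0"
  using pos[of n] by simp

lemma \<kappa>_summable: "summable (\<lambda>n. of_real (1 / (\<zeta> n)\<^sup>2) * t ^ n :: complex)"
proof -
  \<comment> \<open>Any bound \<open>M \<ge> 1\<close> whose square dominates
    \<open>2 * cmod t\<close> would do: the terms are then eventually below those of the geometric
    series with ratio 1/2.\<close>
  define M where "M = 2 * cmod t + 1"
  have M: "M \<ge> 1" "2 * cmod t \<le> M\<^sup>2"
    by (auto simp: M_def power2_eq_square algebra_simps)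
  have "eventually (\<lambda>n. root n (\<zeta> n) \<ge> M) sequentially"
    using lim by (simp add: filterlim_at_top)
  then have "eventually (\<lambda>n. norm (of_real (1 / (\<zeta> n)\<^sup>2) * t ^ n) \<le> (1/2) ^ n) sequentially"
    using eventually_gt_at_top[of 0]
  proof eventually_elim
    case (elim n)
    have "M ^ n \<le> root n (\<zeta> n) ^ n" using elim M by (intro power_mono) auto
    also have "\<dots> = \<zeta> n" using elim pos[of n] by simp
    finally have "(M ^ n)\<^sup>2 \<le> (\<zeta> n)\<^sup>2" using M by (intro power_mono) auto
    then have "(M\<^sup>2) ^ n \<le> (\<zeta> n)\<^sup>2" by (simp add: power_mult [symmetric] mult.commute)
    moreover have "(2 * cmod t) ^ n \<le> (M\<^sup>2) ^ n" using M by (intro power_mono) auto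
    ultimately have "(2 * cmod t) ^ n \<le> (\<zeta> n)\<^sup>2" by linarith
    then show ?case using pos[of n]
      by (simp add: norm_mult norm_divide norm_power field_simps power_mult_distrib)
  qed
  then show ?thesis by (rule summable_comparison_test_ev) (simp add: summable_geometric)
qed

lemma \<kappa>_sums: "(\<lambda>n. of_real (1 / (\<zeta> n)\<^sup>2) * t ^ n) sums \<kappa> t"
  using summable_sums[OF \<kappa>_summable[of t]] by (simp add: \<kappa>_def eval_fps_def)

lemma HE_kernel_eq: "HE_kernel \<zeta> p w = \<kappa> (cnj p * w)"
  using \<kappa>_sums[of "cnj p * w"]
  by (simp add: HE_kernel_def sums_iff power_mult_distrib mult.assoc)

lemma isCont_\<kappa>: "isCont \<kappa> t"
proof -
  have "\<kappa> holomorphic_on UNIV" by (rule holomorphic_power_series_UNIV[OF \<kappa>_sums])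
  then show ?thesis
    using continuous_on_eq_continuous_at holomorphic_on_imp_continuous_on open_UNIV by blast
qed

text \<open>All terms are nonnegative, so the first two bound the sum from below. The constant term
  keeps the diagonal values away from 0; the linear one separates \<open>\<kappa> 1\<close> from
  \<open>\<kappa> 0\<close>.\<close>

lemma \<kappa>_of_real:
  assumes "t \<ge> 0"
  obtains s where "\<kappa> (of_real t) = of_real s" "s \<ge> 1 / (\<zeta> 0)\<^sup>2 + t / (\<zeta> 1)\<^sup>2"
proof -
  let ?a = "\<lambda>n. 1 / (\<zeta> n)\<^sup>2 * t ^ n"
  have eq: "(\<lambda>n. of_real (1 / (\<zeta> n)\<^sup>2) * of_real t ^ n) = (\<lambda>n. complex_of_real (?a n))"
    by simp
  have s: "summable ?a"
    using \<kappa>_summable[of "of_real t"] unfolding eq summable_complex_of_real .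
  have "(\<lambda>n. complex_of_real (?a n)) sums of_real (suminf ?a)"
    using s by (intro sums_of_real summable_sums)
  with \<kappa>_sums[of "of_real t"] have "\<kappa> (of_real t) = of_real (suminf ?a)"
    unfolding eq using sums_unique2 by blast
  moreover have "sum ?a {..<2} \<le> suminf ?a"
    by (rule sum_le_suminf[OF s]) (use assms in auto)
  ultimately show ?thesis using that by (simp add: numeral_2_eq_2)
qed

lemma \<kappa>_0: "\<kappa> 0 = of_real (1 / (\<zeta> 0)\<^sup>2)"
  by (simp add: \<kappa>_def eval_fps_at_0)

lemma \<kappa>_1_neq_\<kappa>_0: "\<kappa> 1 \<noteq> \<kappa> 0"
proof -
  obtain s where s: "\<kappa> (of_real 1) = of_real s" "s \<ge> 1 / (\<zeta> 0)\<^sup>2 + 1 / (\<zeta> 1)\<^sup>2"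
    using \<kappa>_of_real[of 1] by auto
  have "1 / (\<zeta> 1)\<^sup>2 > 0" by simp
  with s(2) have "s \<noteq> 1 / (\<zeta> 0)\<^sup>2" by linarith
  with s(1) show ?thesis unfolding \<kappa>_0 of_real_1 by (metis of_real_eq_iff)
qed

lemma \<kappa>_diag_nz: "\<kappa> (cnj p * p) \<noteq> 0"
proof -
  obtain s where s: "\<kappa> (of_real ((cmod p)\<^sup>2)) = of_real s"
    "s \<ge> 1 / (\<zeta> 0)\<^sup>2 + (cmod p)\<^sup>2 / (\<zeta> 1)\<^sup>2"
    using \<kappa>_of_real[of "(cmod p)\<^sup>2"] by auto
  have "1 / (\<zeta> 0)\<^sup>2 > 0" "(cmod p)\<^sup>2 / (\<zeta> 1)\<^sup>2 \<ge> 0" by simp_all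
  with s(2) have "s \<noteq> 0" by linarith
  moreover have "cnj p * p = of_real ((cmod p)\<^sup>2)"
    by (metis complex_norm_square mult.commute)
  ultimately show ?thesis using s(1) by simp
qed

section \<open>Combinations of two kernels, as needed for polarization\<close>

definition kcomb :: "complex \<Rightarrow> complex \<Rightarrow> complex \<Rightarrow> complex \<Rightarrow> complex \<Rightarrow> complex" where
  "kcomb a p b q = (\<lambda>z. a * HE_kernel \<zeta> p z + b * HE_kernel \<zeta> q z)"

lemma kcomb_sums:
  "(\<lambda>n. (a * cnj p ^ n + b * cnj q ^ n) * of_real (1 / (\<zeta> n)\<^sup>2) * z ^ n) sums kcomb a p b q z"
proof -
  have "(\<lambda>n. a * (of_real (1 / (\<zeta> n)\<^sup>2) * (cnj p * z) ^ n)
      + b * (of_real (1 / (\<zeta> n)\<^sup>2) * (cnj q * z) ^ n)) sums kcomb a p b q z"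
    unfolding kcomb_def HE_kernel_eq by (intro sums_add sums_mult \<kappa>_sums)
  then show ?thesis
    by (simp add: algebra_simps power_mult_distrib add_divide_distrib)
qed

lemma tcoeff_kcomb:
  "tcoeff (kcomb a p b q) n = (a * cnj p ^ n + b * cnj q ^ n) * of_real (1 / (\<zeta> n)\<^sup>2)"
  by (rule tcoeff_power_series[OF kcomb_sums])

lemma kcomb_holomorphic: "kcomb a p b q holomorphic_on UNIV"
  by (rule holomorphic_power_series_UNIV[OF kcomb_sums])

text \<open>Expanding only the conjugated factor of each squared modulus cancels the weight and
  leaves the power series of the combination at \<open>p\<close> and at \<open>q\<close>.\<close>

lemma kcomb_norm_sums:
  "(\<lambda>n. complex_of_real ((cmod (tcoeff (kcomb a p b q) n))\<^sup>2 * (\<zeta> n)\<^sup>2)) sums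
   (cnj a * kcomb a p b q p + cnj b * kcomb a p b q q)"
proof -
  have "(\<lambda>n. cnj a * ((a * cnj p ^ n + b * cnj q ^ n) * of_real (1 / (\<zeta> n)\<^sup>2) * p ^ n)
      + cnj b * ((a * cnj p ^ n + b * cnj q ^ n) * of_real (1 / (\<zeta> n)\<^sup>2) * q ^ n))
     sums (cnj a * kcomb a p b q p + cnj b * kcomb a p b q q)"
    by (intro sums_add sums_mult kcomb_sums)
  moreover have "cnj a * ((a * cnj p ^ n + b * cnj q ^ n) * of_real (1 / (\<zeta> n)\<^sup>2) * p ^ n)
      + cnj b * ((a * cnj p ^ n + b * cnj q ^ n) * of_real (1 / (\<zeta> n)\<^sup>2) * q ^ n)
    = complex_of_real ((cmod (tcoeff (kcomb a p b q) n))\<^sup>2 * (\<zeta> n)\<^sup>2)" for n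
    unfolding tcoeff_kcomb of_real_mult complex_norm_square
    by (simp add: field_simps power2_eq_square)
  ultimately show ?thesis by simp
qed

lemma
  shows kcomb_in_HE: "kcomb a p b q \<in> HE \<zeta>"
    and kcomb_norm: "of_real ((HE_norm \<zeta> (kcomb a p b q))\<^sup>2)
      = cnj a * kcomb a p b q p + cnj b * kcomb a p b q q"
proof -
  have s: "summable (\<lambda>n. (cmod (tcoeff (kcomb a p b q) n))\<^sup>2 * (\<zeta> n)\<^sup>2)"
    using sums_summable[OF kcomb_norm_sums] unfolding summable_complex_of_real .
  show "kcomb a p b q \<in> HE \<zeta>"
    using s kcomb_holomorphic by (simp add: HE_def)
  have "(HE_norm \<zeta> (kcomb a p b q))\<^sup>2 = (\<Sum>n. (cmod (tcoeff (kcomb a p b q) n))\<^sup>2 * (\<zeta> n)\<^sup>2)"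
    unfolding HE_norm_def by (intro real_sqrt_pow2 suminf_nonneg s) simp
  moreover have "(\<lambda>n. complex_of_real ((cmod (tcoeff (kcomb a p b q) n))\<^sup>2 * (\<zeta> n)\<^sup>2)) sums
      of_real (\<Sum>n. (cmod (tcoeff (kcomb a p b q) n))\<^sup>2 * (\<zeta> n)\<^sup>2)"
    using s by (intro sums_of_real summable_sums)
  ultimately show "of_real ((HE_norm \<zeta> (kcomb a p b q))\<^sup>2)
      = cnj a * kcomb a p b q p + cnj b * kcomb a p b q q"
    using sums_unique2[OF _ kcomb_norm_sums] by simp
qed

lemma scaled_kernel_in_HE: "(\<lambda>z. c * HE_kernel \<zeta> p z) \<in> HE \<zeta>"
  using kcomb_in_HE[of c p 0 0] by (simp add: kcomb_def)

lemma kernel_in_HE: "HE_kernel \<zeta> p \<in> HE \<zeta>"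
  using scaled_kernel_in_HE[of 1 p] by simp

lemma tcoeff_scaled_kernel:
  "tcoeff (\<lambda>z. c * HE_kernel \<zeta> p z) n = c * cnj p ^ n * of_real (1 / (\<zeta> n)\<^sup>2)"
  using tcoeff_kcomb[of c p 0 0 n] by (simp add: kcomb_def)

section \<open>The reproducing property and the adjoint\<close>

lemma inner_scaled_kernel:
  assumes "f \<in> HE \<zeta>"
  shows "HE_inner \<zeta> f (\<lambda>z. c * HE_kernel \<zeta> p z) = cnj c * f p"
proof -
  have "(\<lambda>n. cnj c * (tcoeff f n * p ^ n)) sums (cnj c * f p)"
    using assms by (intro sums_mult sums_tcoeff) (simp add: HE_def)
  moreover have "tcoeff f n * cnj (tcoeff (\<lambda>z. c * HE_kernel \<zeta> p z) n) * of_real ((\<zeta> n)\<^sup>2)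
    = cnj c * (tcoeff f n * p ^ n)" for n
    unfolding tcoeff_scaled_kernel by (simp add: field_simps)
  ultimately show ?thesis unfolding HE_inner_def by (simp only: sums_iff)
qed

text \<open>With the kernel in the first slot, the inner product reads off point values of
  \<open>h\<close>; this yields uniqueness of the adjoint's value.\<close>

lemma kernel_inner:
  assumes "h \<in> HE \<zeta>"
  shows "HE_inner \<zeta> (HE_kernel \<zeta> p) h = cnj (h p)"
proof -
  have "(\<lambda>n. cnj (tcoeff h n * p ^ n)) sums cnj (h p)"
    using assms sums_tcoeff[of h p] by (simp only: sums_cnj) (simp add: HE_def)
  moreover have "tcoeff (HE_kernel \<zeta> p) n * cnj (tcoeff h n) * of_real ((\<zeta> n)\<^sup>2)
    = cnj (tcoeff h n * p ^ n)" for n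
    using tcoeff_scaled_kernel[of 1 p n] by simp
  ultimately show ?thesis unfolding HE_inner_def by (simp only: sums_iff)
qed

text \<open>Pairing \<open>wcomp \<Upsilon> \<Phi> f\<close> with the kernel at \<open>p\<close>
  gives \<open>\<Upsilon> p * f (\<Phi> p)\<close>, again an evaluation of \<open>f\<close>. Testing
  any other candidate against the kernels fixes its value at each point.\<close>

lemma adjoint_wcomp_kernel:
  assumes "HE_bounded_op \<zeta> (wcomp \<Upsilon> \<Phi>)"
  shows "HE_adjoint \<zeta> (wcomp \<Upsilon> \<Phi>) (HE_kernel \<zeta> p)
    = (\<lambda>z. cnj (\<Upsilon> p) * HE_kernel \<zeta> (\<Phi> p) z)" (is "_ = ?h")
  unfolding HE_adjoint_def
proof (rule the_equality)
  have S: "wcomp \<Upsilon> \<Phi> f \<in> HE \<zeta>" if "f \<in> HE \<zeta>" for f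
    using assms that by (auto simp: HE_bounded_op_def)
  have eq: "HE_inner \<zeta> (wcomp \<Upsilon> \<Phi> f) (HE_kernel \<zeta> p) = HE_inner \<zeta> f ?h" if "f \<in> HE \<zeta>" for f
    using inner_scaled_kernel[OF S[OF that], of 1 p] inner_scaled_kernel[OF that]
    by (simp add: wcomp_def)
  then show "?h \<in> HE \<zeta> \<and> (\<forall>f\<in>HE \<zeta>. HE_inner \<zeta> (wcomp \<Upsilon> \<Phi> f) (HE_kernel \<zeta> p) = HE_inner \<zeta> f ?h)"
    using scaled_kernel_in_HE by blast
  fix h
  assume h: "h \<in> HE \<zeta> \<and>
    (\<forall>f\<in>HE \<zeta>. HE_inner \<zeta> (wcomp \<Upsilon> \<Phi> f) (HE_kernel \<zeta> p) = HE_inner \<zeta> f h)"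
  show "h = ?h"
  proof
    fix w
    have "HE_inner \<zeta> (HE_kernel \<zeta> w) h = HE_inner \<zeta> (HE_kernel \<zeta> w) ?h"
      using h eq kernel_in_HE by metis
    then have "cnj (h w) = cnj (?h w)"
      using h kernel_inner scaled_kernel_in_HE by metis
    then show "h w = ?h w" by (simp only: complex_cnj_cancel_iff)
  qed
qed

text \<open>The adjoint is linear and preserves norms; comparing norms of
  \<open>kcomb 1 p b q\<close> and its image for several \<open>b\<close> polarizes this to pairs of
  kernels.\<close>

lemma coisometry_functional_equation:
  assumes "HE_coisometry \<zeta> (wcomp \<Upsilon> \<Phi>)"
  shows "\<kappa> (cnj p * q) = cnj (\<Upsilon> p) * \<Upsilon> q * \<kappa> (cnj (\<Phi> p) * \<Phi> q)"
proof -
  define T where "T = HE_adjoint \<zeta> (wcomp \<Upsilon> \<Phi>)"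
  have T: "HE_bounded_op \<zeta> T" "\<And>g. g \<in> HE \<zeta> \<Longrightarrow> HE_norm \<zeta> (T g) = HE_norm \<zeta> g"
    using assms by (auto simp: HE_coisometry_def HE_isometry_def T_def)
  have TK: "T (HE_kernel \<zeta> p) = (\<lambda>z. cnj (\<Upsilon> p) * HE_kernel \<zeta> (\<Phi> p) z)" for p
    unfolding T_def using assms by (intro adjoint_wcomp_kernel) (simp add: HE_coisometry_def)
  have "T (kcomb 1 p b q) = kcomb (cnj (\<Upsilon> p)) (\<Phi> p) (b * cnj (\<Upsilon> q)) (\<Phi> q)" for p b q
  proof -
    have "T (kcomb 1 p b q) = (\<lambda>z. T (HE_kernel \<zeta> p) z + T (\<lambda>z. b * HE_kernel \<zeta> q z) z)"
      unfolding kcomb_def mult_1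
      using T(1) kernel_in_HE scaled_kernel_in_HE by (simp add: HE_bounded_op_def)
    also have "T (\<lambda>z. b * HE_kernel \<zeta> q z) = (\<lambda>z. b * T (HE_kernel \<zeta> q) z)"
      using T(1) kernel_in_HE by (simp add: HE_bounded_op_def)
    finally show ?thesis by (simp add: TK kcomb_def mult.assoc)
  qed
  then have eq: "of_real ((HE_norm \<zeta> (kcomb (cnj (\<Upsilon> p)) (\<Phi> p) (b * cnj (\<Upsilon> q)) (\<Phi> q)))\<^sup>2)
      = complex_of_real ((HE_norm \<zeta> (kcomb 1 p b q))\<^sup>2)" for p b q
    using T(2)[OF kcomb_in_HE] by metis
  \<comment> \<open>The defect of the desired equation. Taking \<open>b = 0\<close> kills it on the
    diagonal; \<open>b = 1\<close> and \<open>b = \<i>\<close> then isolate the sum and the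
    difference of the two mixed terms.\<close>
  define D where "D p q = cnj (\<Upsilon> p) * \<Upsilon> q * \<kappa> (cnj (\<Phi> p) * \<Phi> q) - \<kappa> (cnj p * q)" for p q
  have D: "D p p + b * D q p + cnj b * D p q + b * cnj b * D q q = 0" for p b q
    using eq[of p b q] unfolding kcomb_norm unfolding kcomb_def HE_kernel_eq D_def
    by (simp add: algebra_simps)
  have diag: "D p p = 0" for p using D[of p 0] by simp
  have "D q p + D p q = 0" "\<i> * D q p - \<i> * D p q = 0"
    using D[of p 1 q] D[of p \<i> q] by (simp_all add: diag)
  then have "D p q = 0" by (simp add: algebra_simps)
  then show ?thesis by (simp add: D_def)
qed

section \<open>The contraction argument for the modulus of \<open>\<nu>\<close>\<close>

lemma coisometry_modulus:
  assumes fe: "\<And>p q. \<kappa> (cnj p * q)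
      = cnj (\<Upsilon> p) * \<Upsilon> q * \<kappa> (cnj (\<nu> * p - d) * (\<nu> * q - d))"
    and "cmod \<nu> \<le> 1"
  shows "cmod \<nu> = 1"
proof (rule ccontr)
  assume "cmod \<nu> \<noteq> 1"
  with assms(2) have \<nu>: "cmod \<nu> < 1" by simp
  define z0 where "z0 = - d / (1 - \<nu>)"
  have "\<nu> \<noteq> 1" using \<nu> by auto
  then have z0: "\<nu> * z0 - d = z0" by (simp add: z0_def divide_simps algebra_simps)
  define A where "A p q = \<kappa> (cnj p * q)" for p q
  have fe: "A p q = cnj (\<Upsilon> p) * \<Upsilon> q * A (\<nu> * p - d) (\<nu> * q - d)" for p q
    unfolding A_def by (rule fe)
  have \<Upsilon>: "\<Upsilon> p \<noteq> 0" for p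
    using fe[of p p] \<kappa>_diag_nz[of p] by (auto simp: A_def)
  \<comment> \<open>The normalized quantity equals \<open>\<kappa> 0 / \<kappa> 1\<close>, with
    denominators cleared and \<open>A q p\<close> standing for the conjugate of
    \<open>A p q\<close>.\<close>
  define I where "I p q \<longleftrightarrow> A p q * A q p * \<kappa> 1 = \<kappa> 0 * (A p p * A q q)" for p q
  have step: "I (\<nu> * p - d) (\<nu> * q - d)" if "I p q" for p q
  proof -
    \<comment> \<open>Both \<open>A p q * A q p\<close> and \<open>A p p * A q q\<close> pick up
      this same nonzero factor, which therefore cancels.\<close>
    let ?c = "cnj (\<Upsilon> p) * \<Upsilon> p * cnj (\<Upsilon> q) * \<Upsilon> q"
    let ?p = "\<nu> * p - d" and ?q = "\<nu> * q - d"
    have "?c * (A ?p ?q * A ?q ?p * \<kappa> 1) = A p q * A q p * \<kappa> 1"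
      by (subst (3 4) fe) (simp only: mult_ac)
    also have "\<dots> = \<kappa> 0 * (A p p * A q q)" using that by (simp add: I_def)
    also have "\<dots> = ?c * (\<kappa> 0 * (A ?p ?p * A ?q ?q))"
      by (subst (1 2) fe) (simp only: mult_ac)
    finally show ?thesis using \<Upsilon> by (simp add: I_def)
  qed
  \<comment> \<open>Closed form of the orbit of \<open>w\<close>: about its fixed point
    \<open>z0\<close> the affine map is multiplication by \<open>\<nu>\<close>.\<close>
  define u where "u w n = \<nu> ^ n * (w - z0) + z0" for w n
  have u_Suc: "u w (Suc n) = \<nu> * u w n - d" for w n
    using z0 by (simp add: u_def algebra_simps)
  have "I (u 0 n) (u 1 n)" for n
  proof (induction n)
    case 0
    \<comment> \<open>At the points 0 and 1, \<open>A\<close> equals \<open>\<kappa> 0\<close>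
      except for \<open>A 1 1 = \<kappa> 1\<close>.\<close>
    show ?case by (simp add: I_def u_def A_def)
  next
    case (Suc n)
    then show ?case unfolding u_Suc by (rule step)
  qed
  then have I: "(\<lambda>n. A (u 0 n) (u 1 n) * A (u 1 n) (u 0 n) * \<kappa> 1)
      = (\<lambda>n. \<kappa> 0 * (A (u 0 n) (u 0 n) * A (u 1 n) (u 1 n)))"
    by (simp add: I_def)
  have "u w \<longlonglongrightarrow> 0 * (w - z0) + z0" for w
    unfolding u_def using \<nu> by (intro tendsto_intros LIMSEQ_power_zero) simp
  then have lim: "u w \<longlonglongrightarrow> z0" for w by simp
  have A: "(\<lambda>n. A (u v n) (u w n)) \<longlonglongrightarrow> A z0 z0" for v w
    unfolding A_def by (intro isCont_tendsto_compose[OF isCont_\<kappa>] tendsto_intros lim)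
  have "(\<lambda>n. A (u 0 n) (u 1 n) * A (u 1 n) (u 0 n) * \<kappa> 1) \<longlonglongrightarrow> A z0 z0 * A z0 z0 * \<kappa> 1"
    by (intro tendsto_intros A)
  moreover have "(\<lambda>n. \<kappa> 0 * (A (u 0 n) (u 0 n) * A (u 1 n) (u 1 n)))
      \<longlonglongrightarrow> \<kappa> 0 * (A z0 z0 * A z0 z0)"
    by (intro tendsto_intros A)
  ultimately have "A z0 z0 * A z0 z0 * \<kappa> 1 = \<kappa> 0 * (A z0 z0 * A z0 z0)"
    unfolding I by (rule LIMSEQ_unique)
  \<comment> \<open>Cancelling the nonzero \<open>A z0 z0\<close> would leave
    \<open>\<kappa> 1 = \<kappa> 0\<close>.\<close>
  then show False
    using \<kappa>_1_neq_\<kappa>_0 \<kappa>_diag_nz[of z0] by (simp add: A_def)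
qed

end

theorem theorem3p6:
  fixes \<zeta> :: "nat \<Rightarrow> real" and \<nu> d :: complex and \<Phi> \<Upsilon> :: "complex \<Rightarrow> complex"
  assumes "\<And>n. \<zeta> n > 0"
    and "filterlim (\<lambda>n. root n (\<zeta> n)) at_top sequentially"
    and "cmod \<nu> \<le> 1"
    and "\<Phi> = (\<lambda>z. \<nu> * z - d)"
    and "\<Upsilon> holomorphic_on UNIV"
    and "HE_bounded_op \<zeta> (wcomp \<Upsilon> \<Phi>)"
    and "HE_coisometry \<zeta> (wcomp \<Upsilon> \<Phi>)"
  shows "let K = HE_kernel \<zeta> (cnj \<nu> * d);
             \<alpha> = 1 / (cnj (\<Upsilon> 0) * of_real (HE_norm \<zeta> K))
         in (\<forall>z. \<Upsilon> z = \<alpha> * (K z / of_real (HE_norm \<zeta> K))) \<and>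
            cmod \<alpha> = \<zeta> 0 \<and> cmod \<nu> = 1"
proof -
  interpret entire_weight \<zeta> using assms(1,2) by unfold_locales auto
  have fe: "\<kappa> (cnj p * q) = cnj (\<Upsilon> p) * \<Upsilon> q * \<kappa> (cnj (\<nu> * p - d) * (\<nu> * q - d))" for p q
    using coisometry_functional_equation[OF assms(7)] assms(4) by simp
  have \<nu>: "cmod \<nu> = 1" by (rule coisometry_modulus[OF fe assms(3)])
  \<comment> \<open>The zero of \<open>\<Phi>\<close>, as \<open>cmod \<nu> = 1\<close>; there the
    kernel on the right of \<open>fe\<close> collapses to the constant
    \<open>\<kappa> 0\<close>.\<close>
  define p where "p = cnj \<nu> * d"
  define N where "N = HE_norm \<zeta> (HE_kernel \<zeta> p)"
  have "\<nu> * cnj \<nu> = 1" using complex_norm_square[of \<nu>] \<nu> by simp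
  then have "\<nu> * p - d = 0" by (simp add: p_def mult.assoc[symmetric])
  then have \<Upsilon>p: "HE_kernel \<zeta> p q = cnj (\<Upsilon> p) * \<Upsilon> q * of_real (1 / (\<zeta> 0)\<^sup>2)" for q
    using fe[of p q] by (simp add: \<kappa>_0 HE_kernel_eq)
  have N2: "of_real (N\<^sup>2) = HE_kernel \<zeta> p p"
    using kcomb_norm[of 1 p 0 0] by (simp add: kcomb_def N_def)
  have "N \<noteq> 0" using N2 \<kappa>_diag_nz[of p] by (auto simp: HE_kernel_eq)
  moreover have "N \<ge> 0"
    using kernel_in_HE[of p] by (simp add: N_def HE_norm_def HE_def suminf_nonneg)
  ultimately have N: "N > 0" by simp
  have "cnj (\<Upsilon> p) * \<Upsilon> 0 = 1"
    using \<Upsilon>p[of 0] by (simp add: HE_kernel_eq \<kappa>_0)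
  moreover from this have nz: "\<Upsilon> 0 \<noteq> 0" by auto
  ultimately have inv: "cnj (\<Upsilon> p) = 1 / \<Upsilon> 0" by (simp add: field_simps)
  have \<Upsilon>p_eq: "\<Upsilon> p = 1 / cnj (\<Upsilon> 0)"
    using arg_cong[OF inv, of cnj] by simp
  \<comment> \<open>This identity serves twice: its modulus form gives the absolute value of the
    constant, and it trades the weight at 0 for \<open>N\<close> in the formula for
    \<open>\<Upsilon>\<close>.\<close>
  have eq: "of_real (N\<^sup>2) * (\<Upsilon> 0 * cnj (\<Upsilon> 0)) * of_real ((\<zeta> 0)\<^sup>2) = 1"
    unfolding N2 \<Upsilon>p[of p] inv \<Upsilon>p_eq using nz by simp
  then have "complex_of_real (N\<^sup>2 * (cmod (\<Upsilon> 0))\<^sup>2 * (\<zeta> 0)\<^sup>2) = of_real 1"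
    by (simp only: of_real_mult complex_norm_square[symmetric] of_real_1)
  then have "(N * cmod (\<Upsilon> 0) * \<zeta> 0)\<^sup>2 = 1"
    unfolding of_real_eq_iff power_mult_distrib .
  moreover have "N * cmod (\<Upsilon> 0) * \<zeta> 0 \<ge> 0" using N pos[of 0] by simp
  ultimately have norm: "N * cmod (\<Upsilon> 0) * \<zeta> 0 = 1"
    by (simp add: power2_eq_1_iff)
  then have "cmod (1 / (cnj (\<Upsilon> 0) * of_real N)) = \<zeta> 0"
    using N nz by (simp add: norm_mult norm_divide field_simps)
  moreover have "\<Upsilon> z = 1 / (cnj (\<Upsilon> 0) * of_real N) * (HE_kernel \<zeta> p z / of_real N)" for z
    unfolding \<Upsilon>p[of z] inv using eq N nz
    by (simp add: field_simps power2_eq_square)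
  ultimately show ?thesis
    using \<nu> unfolding Let_def p_def[symmetric] N_def[symmetric] by blast
qed

end
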